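(* Let $\mathcal{A}$ be an order $k$ dimension $n$ real tensor. If $\mathcal{A}$ has an order $m$ sign left inverse or an order $m$ sign right inverse, then $\mathcal{A}$ is a sign nonsingular tensor.
   Context: For dimension $n$ tensors $\mathcal{A}=(a_{i_1\cdots i_m})$ (order $m\ge2$) and $\mathcal{B}=(b_{i_1\cdots i_k})$ (order $k\ge1$), the product $\mathcal{A}\cdot\mathcal{B}$ is the order $(m-1)(k-1)+1$ tensor with entries $(\mathcal{A}\cdot\mathcal{B})_{i\alpha_1\cdots\alpha_{m-1}}=\sum_{i_2,\ldots,i_m\in[n]}a_{ii_2\cdots i_m}b_{i_2\alpha_1}\cdots b_{i_m\alpha_{m-1}}$, $i\in[n]$, $\alpha_j\in[n]^{k-1}$. $\mathcal{I}=(\delta_{i_1\cdots i_k})$ is the unit tensor ($1$ if all indices equal, $0$ otherwise). If $\mathcal{P}\cdot\mathcal{B}=\mathcal{I}$ with $\mathcal{P}$ of order $m$, $\mathcal{P}$ is an order $m$ left inverse of $\mathcal{B}$; if $\mathcal{B}\cdot\mathcal{Q}=\mathcal{I}$ with $\mathcal{Q}$ of order $m$, $\mathcal{Q}$ is an order $m$ right inverse of $\mathcal{B}$. $\mathcal{Q}(\mathcal{A})$ is the set of real tensors with the same entrywise sign pattern as $\mathcal{A}$; $\mathcal{A}$ has an order $m$ sign left (right) inverse if every tensor in $\mathcal{Q}(\mathcal{A})$ has an order $m$ left (right) inverse. The determinant ${\rm det}(\mathcal{A})$ is the resultant of the system $\mathcal{A}x^{k-1}=0$ where $(\mathcal{A}x^{k-1})_i=\sum_{i_2,\ldots,i_k}a_{ii_2\cdots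 i_k}x_{i_2}\cdots x_{i_k}$; ${\rm det}(\mathcal{A})=0$ iff this system has a nonzero complex solution. $\mathcal{A}$ is sign nonsingular if ${\rm det}(\widetilde{\mathcal{A}})\neq0$ for every $\widetilde{\mathcal{A}}\in\mathcal{Q}(\mathcal{A})$. *)

theory Defs
  imports Complex_Main "HOL-Library.Multiset" "HOL-Library.Poly_Mapping"
    "HOL-Computational_Algebra.Factorial_Ring"
begin

section \<open>Tensors and their product\<close>

text \<open>
  An order \<open>k\<close> tensor of dimension \<open>n = CARD('n)\<close> is a function on index lists. Only its values
  on lists of length \<open>k\<close> matter; the order is an explicit argument wherever it is needed.
\<close>

type_synonym ('n, 'a) tensor = "'n list \<Rightarrow> 'a"

definition unit_tensor :: "('n, 'a::comm_ring_1) tensor" where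
  "unit_tensor idx = (if \<forall>x\<in>set idx. \<forall>y\<in>set idx. x = y then 1 else 0)"

text \<open>
  Product of an order \<open>m\<close> and an order \<open>k\<close> tensor. An index of the product is
  \<open>i # \<alpha>\<^sub>1 @ \<dots> @ \<alpha>\<^bsub>m-1\<^esub>\<close> with blocks of length \<open>k - 1\<close>;
  \<open>index_block k j idx\<close> is the block \<open>\<alpha>\<^bsub>j+1\<^esub>\<close>.
\<close>

definition index_block :: "nat \<Rightarrow> nat \<Rightarrow> 'n list \<Rightarrow> 'n list" where
  "index_block k j idx = take (k - 1) (drop (j * (k - 1)) (tl idx))"

definition tensor_prod ::
  "nat \<Rightarrow> nat \<Rightarrow> ('n::finite, 'a::comm_ring_1) tensor \<Rightarrow> ('n, 'a) tensor \<Rightarrow> ('n, 'a) tensor" where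
  "tensor_prod m k A B idx =
     (\<Sum>js | length js = m - 1. A (hd idx # js) * (\<Prod>j<m - 1. B (js ! j # index_block k j idx)))"

definition tensor_eq :: "nat \<Rightarrow> ('n, 'a) tensor \<Rightarrow> ('n, 'a) tensor \<Rightarrow> bool" where
  "tensor_eq r A B \<longleftrightarrow> (\<forall>idx. length idx = r \<longrightarrow> A idx = B idx)"

definition has_left_inverse :: "nat \<Rightarrow> nat \<Rightarrow> ('n::finite, 'a::comm_ring_1) tensor \<Rightarrow> bool" where
  "has_left_inverse m k B \<longleftrightarrow>
     (\<exists>P. tensor_eq ((m - 1) * (k - 1) + 1) (tensor_prod m k P B) unit_tensor)"

definition has_right_inverse :: "nat \<Rightarrow> nat \<Rightarrow> ('n::finite, 'a::comm_ring_1) tensor \<Rightarrow> bool" where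
  "has_right_inverse m k B \<longleftrightarrow>
     (\<exists>Q. tensor_eq ((k - 1) * (m - 1) + 1) (tensor_prod k m B Q) unit_tensor)"


section \<open>Sign classes\<close>

definition sign_class :: "nat \<Rightarrow> ('n, real) tensor \<Rightarrow> ('n, real) tensor set" where
  "sign_class k A = {A'. \<forall>idx. length idx = k \<longrightarrow> sgn (A' idx) = sgn (A idx)}"

text \<open>
  The members of a sign class are real tensors; their inverses may have complex entries (a real
  inverse is in particular a complex one).
\<close>

definition has_sign_left_inverse :: "nat \<Rightarrow> nat \<Rightarrow> ('n::finite, real) tensor \<Rightarrow> bool" where
  "has_sign_left_inverse m k A \<longleftrightarrow>
     (\<forall>A'\<in>sign_class k A. has_left_inverse m k (\<lambda>idx. complex_of_real (A' idx)))"

definition has_sign_right_inverse :: "nat \<Rightarrow> nat \<Rightarrow> ('n::finite, real) tensor \<Rightarrow> bool" where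
  "has_sign_right_inverse m k A \<longleftrightarrow>
     (\<forall>A'\<in>sign_class k A. has_right_inverse m k (\<lambda>idx. complex_of_real (A' idx)))"


section \<open>The resultant and the determinant\<close>

text \<open>
  A monomial of degree \<open>d\<close> in the variables \<open>x\<^sub>i\<close> (\<open>i :: 'n\<close>) is a multiset \<open>\<alpha>\<close> of size \<open>d\<close>.
  A system of \<open>n\<close> forms of degree \<open>d\<close> is its family of coefficients \<open>c (i, \<alpha>)\<close>: the coefficient
  of \<open>x\<^sup>\<alpha>\<close> in the \<open>i\<close>-th form.
\<close>

type_synonym 'n coeff_index = "'n \<times> 'n multiset"

definition form_eval ::
  "nat \<Rightarrow> ('n::finite coeff_index \<Rightarrow> 'a::comm_ring_1) \<Rightarrow> ('n \<Rightarrow> 'a) \<Rightarrow> 'n \<Rightarrow> 'a" where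
  "form_eval d c x i = (\<Sum>\<alpha> | size \<alpha> = d. c (i, \<alpha>) * (\<Prod>j\<in>#\<alpha>. x j))"

text \<open>Polynomials with integer coefficients in the indeterminates \<open>u\<^sub>v\<close> (\<open>v :: 'v\<close>).\<close>

type_synonym 'v int_mpoly = "('v \<Rightarrow>\<^sub>0 nat) \<Rightarrow>\<^sub>0 int"

definition int_mpoly_vars :: "'v int_mpoly \<Rightarrow> 'v set" where
  "int_mpoly_vars R = (\<Union>\<mu>\<in>Poly_Mapping.keys R. Poly_Mapping.keys \<mu>)"

definition int_mpoly_eval :: "'v int_mpoly \<Rightarrow> ('v \<Rightarrow> 'a::comm_ring_1) \<Rightarrow> 'a" where
  "int_mpoly_eval R c =
     (\<Sum>\<mu>\<in>Poly_Mapping.keys R. of_int (Poly_Mapping.lookup R \<mu>) *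
        (\<Prod>v\<in>Poly_Mapping.keys \<mu>. c v ^ Poly_Mapping.lookup \<mu> v))"

text \<open>
  The resultant of \<open>n\<close> generic forms of degree \<open>d \<ge> 1\<close> in \<open>n\<close> variables is the unique irreducible
  integer polynomial in their coefficients that vanishes exactly at the complex systems with a
  nonzero solution and takes the value \<open>1\<close> at the system \<open>x\<^sub>i\<^sup>d = 0\<close> (Cox, Little, O'Shea, Using
  Algebraic Geometry, Ch. 3, Thm. 2.3; Gelfand, Kapranov, Zelevinsky, Ch. 13). Its existence is
  not proved here, so the resultant is specified by this predicate.
\<close>

definition is_resultant :: "nat \<Rightarrow> 'n::finite coeff_index int_mpoly \<Rightarrow> bool" where
  "is_resultant d R \<longleftrightarrow>
     int_mpoly_vars R \<subseteq> {(i, \<alpha>). size \<alpha> = d} \<and>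
     irreducible R \<and>
     (\<forall>c :: 'n coeff_index \<Rightarrow> complex.
        int_mpoly_eval R c = 0 \<longleftrightarrow> (\<exists>x. x \<noteq> (\<lambda>_. 0) \<and> (\<forall>i. form_eval d c x i = 0))) \<and>
     int_mpoly_eval R (\<lambda>(i, \<alpha>). if \<alpha> = replicate_mset d i then 1 else 0) = (1 :: int)"

text \<open>The system \<open>A x\<^bsup>k-1\<^esup> = 0\<close> of an order \<open>k\<close> tensor, and its coefficients.\<close>

definition tensor_apply ::
  "nat \<Rightarrow> ('n::finite, 'a::comm_ring_1) tensor \<Rightarrow> ('n \<Rightarrow> 'a) \<Rightarrow> 'n \<Rightarrow> 'a" where
  "tensor_apply k A x i = (\<Sum>is | length is = k - 1. A (i # is) * (\<Prod>j\<leftarrow>is. x j))"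

definition tensor_coeffs ::
  "nat \<Rightarrow> ('n::finite, 'a::comm_ring_1) tensor \<Rightarrow> 'n coeff_index \<Rightarrow> 'a" where
  "tensor_coeffs k A = (\<lambda>(i, \<alpha>). \<Sum>is | length is = k - 1 \<and> mset is = \<alpha>. A (i # is))"

lemma finite_lists_length: "finite {is :: 'n::finite list. length is = d}"
  using finite_lists_length_eq[of "UNIV :: 'n set" d] by simp

lemma finite_mset_size: "finite {\<alpha> :: 'n::finite multiset. size \<alpha> = d}"
proof -
  have "{\<alpha> :: 'n multiset. size \<alpha> = d} \<subseteq> mset ` {is. length is = d}"
  proof
    fix \<alpha> :: "'n multiset" assume "\<alpha> \<in> {\<alpha>. size \<alpha> = d}"
    moreover obtain l where "mset l = \<alpha>" using ex_mset by blast
    ultimately show "\<alpha> \<in> mset ` {is. length is = d}" by force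
  qed
  then show ?thesis using finite_lists_length finite_surj by blast
qed

lemma form_eval_tensor_coeffs:
  "form_eval (k - 1) (tensor_coeffs k A) x i = tensor_apply k A x i"
proof -
  have p: "(\<Prod>j\<in>#mset is. x j) = (\<Prod>j\<leftarrow>is. x j)" for "is"
    by (simp flip: mset_map add: prod_mset_prod_list)
  have "tensor_apply k A x i =
      (\<Sum>\<alpha> | size \<alpha> = k - 1. \<Sum>is\<in>{is. is \<in> {is. length is = k - 1} \<and> mset is = \<alpha>}.
         A (i # is) * (\<Prod>j\<leftarrow>is. x j))"
    unfolding tensor_apply_def
    by (rule sum.group[symmetric]) (auto simp: finite_lists_length finite_mset_size)
  also have "\<dots> = form_eval (k - 1) (tensor_coeffs k A) x i"
    unfolding form_eval_def tensor_coeffs_def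
    by (auto simp: sum_distrib_right p[symmetric] intro!: sum.cong)
  finally show ?thesis by simp
qed

text \<open>
  The determinant of an order \<open>k\<close> tensor: the resultant \<open>R\<close> of \<open>n\<close> generic forms of degree
  \<open>k - 1\<close>, evaluated at the system \<open>A x\<^bsup>k-1\<^esup> = 0\<close>.
\<close>

definition tensor_det ::
  "'n::finite coeff_index int_mpoly \<Rightarrow> nat \<Rightarrow> ('n, 'a::comm_ring_1) tensor \<Rightarrow> 'a" where
  "tensor_det R k A = int_mpoly_eval R (tensor_coeffs k A)"

definition sign_nonsingular ::
  "'n::finite coeff_index int_mpoly \<Rightarrow> nat \<Rightarrow> ('n, real) tensor \<Rightarrow> bool" where
  "sign_nonsingular R k A \<longleftrightarrow> (\<forall>A'\<in>sign_class k A. tensor_det R k A' \<noteq> 0)"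

end

theory Submission
  imports Defs "HOL-Analysis.Cartesian_Space"
begin

text \<open>
  The determinant vanishes iff the system has a nonzero complex solution, so it suffices that an
  invertible complex tensor \<open>B\<close> has only the trivial zero \<open>B x\<^bsup>k-1\<^esup> = 0\<close>.

  Left inverse \<open>P\<close>: contract only the first block of \<open>P \<cdot> B = I\<close> with \<open>x\<close> and put \<open>i\<close> at all the
  remaining places; the left side contains the factor \<open>B x\<^bsup>k-1\<^esup> = 0\<close>, the right side is
  \<open>x\<^sub>i\<^bsup>k-1\<^esup>\<close>.

  Right inverse \<open>Q\<close>: let \<open>v\<^sub>a\<close> be the vector with entries \<open>Q (t, a, \<dots>, a)\<close>. The equation
  \<open>B \<cdot> Q = I\<close> says that the \<open>i\<close>-th multilinear form of \<open>B\<close> is diagonal on the \<open>v\<^sub>a\<close>, so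
  \<open>y = \<Sum>\<^sub>a c\<^sub>a v\<^sub>a\<close> satisfies \<open>(B y\<^bsup>k-1\<^esup>)\<^sub>i = c\<^sub>i\<^bsup>k-1\<^esup>\<close>. Hence the \<open>v\<^sub>a\<close> are linearly
  independent, so they form a basis, and \<open>B y\<^bsup>k-1\<^esup> = 0\<close> forces \<open>c = 0\<close>.
\<close>

lemma unit_tensor_Cons:
  "unit_tensor (i # l) = (if \<forall>x\<in>set l. x = i then 1 else 0)"
  unfolding unit_tensor_def by auto

lemma all_eq_iff_replicate: "length l = d \<Longrightarrow> (\<forall>x\<in>set l. x = i) \<longleftrightarrow> l = replicate d i"
  by (metis in_set_replicate replicate_length_same)

lemma sum_lists_Suc:
  fixes g :: "'n::finite list \<Rightarrow> 'a::comm_monoid_add"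
  shows "(\<Sum>l | length l = Suc d. g l) = (\<Sum>a\<in>UNIV. \<Sum>l | length l = d. g (a # l))"
proof -
  have "{l :: 'n list. length l = Suc d} = (\<lambda>(a, l). a # l) ` (UNIV \<times> {l. length l = d})"
    by (auto simp: length_Suc_conv)
  moreover have "inj_on (\<lambda>(a, l). a # l) (UNIV \<times> {l :: 'n list. length l = d})"
    by (auto simp: inj_on_def)
  ultimately show ?thesis
    by (simp add: sum.reindex sum.cartesian_product case_prod_unfold)
qed

lemma prod_sum_lists:
  fixes f :: "nat \<Rightarrow> 'n::finite \<Rightarrow> 'a::comm_ring_1"
  shows "(\<Prod>j<d. \<Sum>a\<in>UNIV. f j a) = (\<Sum>l | length l = d. \<Prod>j<d. f j (l ! j))"
proof (induction d arbitrary: f)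
  case 0
  show ?case by simp
next
  case (Suc d)
  have "(\<Prod>j<Suc d. \<Sum>a\<in>UNIV. f j a) = (\<Sum>a\<in>UNIV. f 0 a) * (\<Prod>j<d. \<Sum>a\<in>UNIV. f (Suc j) a)"
    by (rule prod.lessThan_Suc_shift)
  also have "\<dots> = (\<Sum>a\<in>UNIV. \<Sum>l | length l = d. f 0 a * (\<Prod>j<d. f (Suc j) (l ! j)))"
    by (simp only: Suc.IH sum_product)
  also have "\<dots> = (\<Sum>l | length l = Suc d. \<Prod>j<Suc d. f j (l ! j))"
    by (simp add: sum_lists_Suc prod.lessThan_Suc_shift del: prod.lessThan_Suc)
  finally show ?case .
qed

lemma prod_list_map_conv_nth:
  fixes x :: "'n \<Rightarrow> 'a::comm_monoid_mult"
  shows "length l = d \<Longrightarrow> (\<Prod>j\<leftarrow>l. x j) = (\<Prod>j<d. x (l ! j))"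
  by (simp add: prod.list_conv_set_nth atLeast0LessThan)

text \<open>At indices made of constant blocks, a right inverse \<open>Q\<close> is seen only
  through its entries \<open>Q (t # replicate (m - 1) a)\<close>.\<close>

lemma index_block_replicate_concat:
  assumes "j < length l"
  shows "index_block m j (i # concat (map (replicate (m - 1)) l)) = replicate (m - 1) (l ! j)"
  using assms unfolding index_block_def
proof (induction l arbitrary: j)
  case Nil
  then show ?case by simp
next
  case (Cons a l)
  then show ?case by (cases j) auto
qed

lemma left_inverse_imp_nonsingular:
  fixes B :: "('n::finite, 'a::idom) tensor"
  assumes k: "k \<ge> 2" and m: "m \<ge> 2"
    and "has_left_inverse m k B"
    and zero: "\<And>i. tensor_apply k B x i = 0"
  shows "x i = 0"
proof -
  obtain P where P: "tensor_eq ((m - 1) * (k - 1) + 1) (tensor_prod m k P B) unit_tensor"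
    using assms(3) unfolding has_left_inverse_def by blast
  \<comment> \<open>Since \<open>m \<ge> 2\<close> there is a first block; \<open>r\<close> counts
    the others.\<close>
  obtain r where r: "m - 1 = Suc r"
    using m by (cases "m - 1") auto
  define idx where "idx l = i # l @ replicate (r * (k - 1)) i" for l
  \<comment> \<open>The factors of the remaining blocks are independent of \<open>l\<close>, so they
    can be pulled out of the sum over \<open>l\<close>.\<close>
  define rest where
    "rest js = (\<Prod>j<r. B (js ! Suc j # take (k - 1) (drop (j * (k - 1)) (replicate (r * (k - 1)) i))))"
    for js
  have prod: "tensor_prod m k P B (idx l) =
      (\<Sum>js | length js = m - 1. P (i # js) * (B (js ! 0 # l) * rest js))"
    if "length l = k - 1" for l
    using that
    by (simp add: tensor_prod_def r idx_def rest_def index_block_def prod.lessThan_Suc_shift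
        del: prod.lessThan_Suc One_nat_def)
  have unit: "tensor_prod m k P B (idx l) = (if l = replicate (k - 1) i then 1 else 0)"
    if "length l = k - 1" for l
  proof -
    have "length (idx l) = (m - 1) * (k - 1) + 1"
      using that by (simp add: idx_def r del: One_nat_def)
    then have "tensor_prod m k P B (idx l) = unit_tensor (idx l)"
      using P unfolding tensor_eq_def by blast
    also have "\<dots> = (if \<forall>x\<in>set l. x = i then 1 else 0)"
      unfolding idx_def unit_tensor_Cons by (intro if_cong) auto
    finally show ?thesis using that by (simp only: all_eq_iff_replicate)
  qed
  have "x i ^ (k - 1) = (\<Sum>l | length l = k - 1. (if l = replicate (k - 1) i then (\<Prod>j\<leftarrow>l. x j) else 0))"
    by (simp add: finite_lists_length sum.If_cases Int_def prod_list_replicate conj_commute cong: conj_cong)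
  also have "\<dots> = (\<Sum>l | length l = k - 1. tensor_prod m k P B (idx l) * (\<Prod>j\<leftarrow>l. x j))"
    by (intro sum.cong refl) (simp add: unit del: One_nat_def)
  also have "\<dots> = (\<Sum>l | length l = k - 1. \<Sum>js | length js = m - 1.
      P (i # js) * (B (js ! 0 # l) * rest js) * (\<Prod>j\<leftarrow>l. x j))"
    by (rule sum.cong) (auto simp: prod sum_distrib_right simp del: One_nat_def)
  also have "\<dots> = (\<Sum>js | length js = m - 1. \<Sum>l | length l = k - 1.
      P (i # js) * (B (js ! 0 # l) * rest js) * (\<Prod>j\<leftarrow>l. x j))"
    by (rule sum.swap)
  also have "\<dots> = (\<Sum>js | length js = m - 1. P (i # js) * rest js * tensor_apply k B x (js ! 0))"
    by (simp add: tensor_apply_def sum_distrib_left mult_ac)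
  \<comment> \<open>The exponent \<open>k - 1\<close> is positive, so
    \<open>x i ^ (k - 1) = 0\<close> gives \<open>x i = 0\<close> in an integral domain.\<close>
  finally show ?thesis
    using k by (simp add: zero)
qed

lemma tensor_apply_right_inverse:
  fixes B :: "('n::finite, 'a::comm_ring_1) tensor"
  assumes Q: "tensor_eq ((k - 1) * (m - 1) + 1) (tensor_prod k m B Q) unit_tensor"
    and m: "m \<ge> 2"
  shows "tensor_apply k B (\<lambda>t. \<Sum>a\<in>UNIV. Q (t # replicate (m - 1) a) * c a) i = c i ^ (k - 1)"
proof -
  let ?V = "\<lambda>t a. Q (t # replicate (m - 1) a)"
  let ?idx = "\<lambda>l. i # concat (map (replicate (m - 1)) l)"
  have prod: "tensor_prod k m B Q (?idx l) =
      (\<Sum>js | length js = k - 1. B (i # js) * (\<Prod>j<k - 1. ?V (js ! j) (l ! j)))"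
    if "length l = k - 1" for l
    using that by (simp add: tensor_prod_def index_block_replicate_concat del: One_nat_def)
  have unit: "tensor_prod k m B Q (?idx l) = (if l = replicate (k - 1) i then 1 else 0)"
    if "length l = k - 1" for l
  proof -
    have "length (concat (map (replicate (m - 1)) l)) = length l * (m - 1)"
      by (induction l) auto
    then have "length (?idx l) = (k - 1) * (m - 1) + 1"
      using that by simp
    then have "tensor_prod k m B Q (?idx l) = unit_tensor (?idx l)"
      using Q unfolding tensor_eq_def by blast
    \<comment> \<open>As \<open>m \<ge> 2\<close>, no block is empty, so every entry of
      \<open>l\<close> occurs in the index.\<close>
    also have "\<dots> = (if \<forall>x\<in>set l. x = i then 1 else 0)"
      unfolding unit_tensor_Cons using m by (intro if_cong) auto
    finally show ?thesis using that by (simp only: all_eq_iff_replicate)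
  qed
  \<comment> \<open>Multiplying out the \<open>k - 1\<close> sums over \<open>a\<close> yields a sum
    over lists \<open>l\<close> that choose one \<open>a\<close> per factor.\<close>
  have "tensor_apply k B (\<lambda>t. \<Sum>a\<in>UNIV. ?V t a * c a) i =
      (\<Sum>js | length js = k - 1. \<Sum>l | length l = k - 1.
        B (i # js) * ((\<Prod>j<k - 1. ?V (js ! j) (l ! j)) * (\<Prod>j\<leftarrow>l. c j)))"
    unfolding tensor_apply_def
    by (rule sum.cong)
      (auto simp: prod_list_map_conv_nth prod_sum_lists sum_distrib_left prod.distrib intro!: sum.cong)
  also have "\<dots> = (\<Sum>l | length l = k - 1. \<Sum>js | length js = k - 1.
        B (i # js) * ((\<Prod>j<k - 1. ?V (js ! j) (l ! j)) * (\<Prod>j\<leftarrow>l. c j)))"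
    by (rule sum.swap)
  also have "\<dots> = (\<Sum>l | length l = k - 1. tensor_prod k m B Q (?idx l) * (\<Prod>j\<leftarrow>l. c j))"
    by (rule sum.cong) (auto simp: prod sum_distrib_right mult.assoc simp del: One_nat_def)
  also have "\<dots> = (\<Sum>l | length l = k - 1. (if l = replicate (k - 1) i then (\<Prod>j\<leftarrow>l. c j) else 0))"
    by (intro sum.cong refl) (simp add: unit del: One_nat_def)
  also have "\<dots> = c i ^ (k - 1)"
    by (simp add: finite_lists_length sum.If_cases Int_def prod_list_replicate conj_commute cong: conj_cong)
  finally show ?thesis .
qed

lemma right_inverse_imp_nonsingular:
  fixes B :: "('n::finite, 'a::field) tensor"
  assumes k: "k \<ge> 2" and m: "m \<ge> 2"
    and "has_right_inverse m k B"
    and zero: "\<And>i. tensor_apply k B x i = 0"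
  shows "x i = 0"
proof -
  obtain Q where Q: "tensor_eq ((k - 1) * (m - 1) + 1) (tensor_prod k m B Q) unit_tensor"
    using assms(3) unfolding has_right_inverse_def by blast
  define V :: "'a^'n^'n" where "V = (\<chi> t a. Q (t # replicate (m - 1) a))"
  have apply_V: "tensor_apply k B (\<lambda>t. (V *v c) $ t) i = c $ i ^ (k - 1)" for c i
    using tensor_apply_right_inverse[OF Q m, of "\<lambda>a. c $ a" i]
    by (simp add: V_def matrix_vector_mult_def)
  have zero_vec: "c = 0" if "\<And>i. tensor_apply k B (\<lambda>t. (V *v c) $ t) i = 0" for c
    using that k by (simp add: apply_V vec_eq_iff)
  \<comment> \<open>The forms have positive degree, so they vanish at 0; hence
    \<open>zero_vec\<close> applies to every \<open>c\<close> in the kernel of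
    \<open>V\<close>.\<close>
  have apply_0: "tensor_apply k B (\<lambda>_. 0) i = 0" for i
    unfolding tensor_apply_def using k
    by (intro sum.neutral) (simp add: map_replicate_const prod_list_replicate)
  have "\<exists>W. W ** V = mat 1"
    unfolding matrix_left_invertible_ker using zero_vec by (simp add: apply_0)
  \<comment> \<open>For square matrices a left inverse yields a right inverse, so \<open>x\<close>
    is the combination of the columns of \<open>V\<close> with coefficient vector
    \<open>W x\<close>.\<close>
  then obtain W where "V ** W = mat 1"
    using matrix_left_right_inverse by blast
  then have x: "x = (\<lambda>t. (V *v (W *v (\<chi> t. x t))) $ t)"
    by (simp add: matrix_vector_mul_assoc)
  then have "W *v (\<chi> t. x t) = 0"
    using zero zero_vec by metis
  with x show ?thesis
    by (metis matrix_vector_mult_0_right zero_index)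
qed

lemma of_real_int_mpoly_eval:
  "of_real (int_mpoly_eval R c) = int_mpoly_eval R (\<lambda>v. of_real (c v) :: 'a::{real_algebra_1, comm_ring_1})"
  by (simp add: int_mpoly_eval_def)

lemma of_real_tensor_coeffs:
  "of_real (tensor_coeffs k A v) = tensor_coeffs k (\<lambda>idx. of_real (A idx) :: 'a::{real_algebra_1, comm_ring_1}) v"
  by (simp add: tensor_coeffs_def case_prod_unfold)

text \<open>The resultant detects zeros over the complex numbers, while sign nonsingularity concerns
  real determinants. Integer coefficients make evaluation commute with the embedding.\<close>

lemma tensor_det_of_real:
  "tensor_det R k (\<lambda>idx. of_real (A idx) :: 'a::{real_algebra_1, comm_ring_1}) = of_real (tensor_det R k A)"
  by (simp add: tensor_det_def of_real_int_mpoly_eval of_real_tensor_coeffs)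

lemma tensor_det_eq_0_iff:
  fixes B :: "('n::finite, complex) tensor"
  assumes "is_resultant (k - 1) R"
  shows "tensor_det R k B = 0 \<longleftrightarrow> (\<exists>x. x \<noteq> (\<lambda>_. 0) \<and> (\<forall>i. tensor_apply k B x i = 0))"
  using assms by (simp add: is_resultant_def tensor_det_def form_eval_tensor_coeffs del: One_nat_def)

theorem theorem4p3:
  fixes A :: "('n::finite, real) tensor"
    and R :: "'n coeff_index int_mpoly"
    and k m :: nat
  assumes "k \<ge> 2" and "m \<ge> 2"
    and "is_resultant (k - 1) R"
    and "has_sign_left_inverse m k A \<or> has_sign_right_inverse m k A"
  shows "sign_nonsingular R k A"
  unfolding sign_nonsingular_def
proof (intro ballI notI)
  fix A' assume A': "A' \<in> sign_class k A" and det: "tensor_det R k A' = 0"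
  let ?B = "\<lambda>idx. complex_of_real (A' idx)"
  have "tensor_det R k ?B = 0"
    by (simp add: tensor_det_of_real det)
  then obtain x where x: "x \<noteq> (\<lambda>_. 0)" "\<And>i. tensor_apply k ?B x i = 0"
    using tensor_det_eq_0_iff[OF assms(3)] by blast
  have "has_left_inverse m k ?B \<or> has_right_inverse m k ?B"
    using assms(4) A' unfolding has_sign_left_inverse_def has_sign_right_inverse_def by blast
  then have "x i = 0" for i
    using left_inverse_imp_nonsingular[OF assms(1,2) _ x(2)]
      right_inverse_imp_nonsingular[OF assms(1,2) _ x(2)] by blast
  with x(1) show False by blast
qed

end
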